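(* Let $p\ge1$. For every $t\ge0$ let $0<m_t\le L_t$, $\sigma_t\ge0$, $c_t\ge0$, $\alpha_t\ge0$. Consider the iteration $x_{t+1}=x_t-\alpha_t(\nabla f_t(x_t)+v_t)$ in $\mathbb R^p$ with deterministic $x_0$. For all $t$ assume: (i) $f_t\in\mathcal S(m_t,L_t)$ with global minimizer $x_t^*$; (ii) $\|x_{t+1}^*-x_t^*\|\le\sigma_t$; (iii) $\{v_t\}$ is a zero-mean IID process satisfying $\mathbb E\|v_t\|^2\le c_t^2$. If there exist non-negative scalars $(\rho_t,\lambda_t^{(1)},\lambda_t^{(2)},\lambda_t^{(3)})$ and real scalars $(\lambda_t^{(4)},\lambda_t^{(5)},\lambda_t^{(6)})$ such that $$\begin{bmatrix}1-\rho_t^2&-\alpha_t&1&-\alpha_t-\lambda_t^{(4)}\\-\alpha_t&\alpha_t^2&-\alpha_t&\alpha_t^2-\lambda_t^{(5)}\\1&-\alpha_t&1-\lambda_t^{(2)}&-\alpha_t-\lambda_t^{(6)}\\-\alpha_t-\lambda_t^{(4)}&\alpha_t^2-\lambda_t^{(5)}&-\alpha_t-\lambda_t^{(6)}&\alpha_t^2-\lambda_t^{(3)}\end{bmatrix}-\lambda_t^{(1)}\begin{bmatrix}Y_t&0_{2\times2}\\0_{2\times2}&0_{2\times2}\end{bmatrix}\preceq0,$$ then $\mathbb E\|x_{t+1}-x_{t+1}^*\|^2\le\rho_t^2\,\mathbb E\|x_t-x_t^*\|^2+\lambda_t^{(2)}\sigma_t^2+\lambda_t^{(3)}c_t^2$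.
   Context: $\mathcal S(m,L)$ is the set of differentiable functions $f:\mathbb R^p\to\mathbb R$ having a unique global minimizer $x^*$ such that for all $x\in\mathbb R^p$ $$\begin{bmatrix}x-x^*\\ \nabla f(x)\end{bmatrix}^T\begin{bmatrix}-2mLI_p&(L+m)I_p\\(L+m)I_p&-2I_p\end{bmatrix}\begin{bmatrix}x-x^*\\ \nabla f(x)\end{bmatrix}\ge0.$$ $Y_t:=\begin{bmatrix}2L_tm_t&-(L_t+m_t)\\-(L_t+m_t)&2\end{bmatrix}$. The functions $f_t$ are deterministic. $P\preceq0$ means the symmetric matrix $P$ is negative semidefinite; norms are Euclidean. *)

theory Defs
  imports "HOL-Probability.Probability"
begin

text \<open>Gradient of \<open>f\<close> at \<open>x\<close>; only meaningful where \<open>f\<close> is differentiable, where \<open>D\<close> is unique.\<close>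
definition gradient :: "('b::euclidean_space \<Rightarrow> real) \<Rightarrow> 'b \<Rightarrow> 'b" where
  "gradient f x = (THE D. GDERIV f x :> D)"

definition stack :: "real^'m \<Rightarrow> real^'n \<Rightarrow> real^('m + 'n)" where
  "stack a b = (\<chi> i. case i of Inl j \<Rightarrow> a $ j | Inr j \<Rightarrow> b $ j)"

definition block_matrix ::
  "real^'m^'k \<Rightarrow> real^'n^'k \<Rightarrow> real^'m^'l \<Rightarrow> real^'n^'l \<Rightarrow> real^('m + 'n)^('k + 'l)" where
  "block_matrix A B C D =
     (\<chi> i. case i of Inl k \<Rightarrow> stack (A $ k) (B $ k) | Inr l \<Rightarrow> stack (C $ l) (D $ l))"

definition matrix2 :: "real \<Rightarrow> real \<Rightarrow> real \<Rightarrow> real \<Rightarrow> real^2^2" where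
  "matrix2 a b c d = vector [vector [a, b], vector [c, d]]"

definition negative_semidefinite :: "real^'n^'n \<Rightarrow> bool" where
  "negative_semidefinite P \<longleftrightarrow> transpose P = P \<and> (\<forall>z. z \<bullet> (P *v z) \<le> 0)"

text \<open>Here \<open>mat k\<close> is \<open>k\<close> times the identity matrix, and \<open>is_arg_min f (\<lambda>_. True)\<close> is the predicate
  of being a global minimizer of \<open>f\<close>.\<close>
definition sector_class :: "real \<Rightarrow> real \<Rightarrow> (real^'p \<Rightarrow> real) set" where
  "sector_class m L =
     {f. (\<forall>x. f differentiable (at x)) \<and>
         (\<exists>xs. (\<forall>z. is_arg_min f (\<lambda>_. True) z \<longleftrightarrow> z = xs) \<and>
           (\<forall>x. stack (x - xs) (gradient f x) \<bullet>
                (block_matrix (mat (- 2 * m * L)) (mat (L + m))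
                              (mat (L + m))       (mat (- 2))
                  *v stack (x - xs) (gradient f x)) \<ge> 0))}"

definition Y_matrix :: "real \<Rightarrow> real \<Rightarrow> real^2^2" where
  "Y_matrix m L = matrix2 (2 * L * m)  (- (L + m))
                          (- (L + m))  2"

text \<open>The 4-by-4 matrix of the linear matrix inequality, split into 2-by-2 blocks (hence the index
  type \<open>2 + 2\<close>), with rows
    \<open>(1 - \<rho>\<^sup>2, -\<alpha>, 1, -\<alpha> - l4)\<close>,
    \<open>(-\<alpha>, \<alpha>\<^sup>2, -\<alpha>, \<alpha>\<^sup>2 - l5)\<close>,
    \<open>(1, -\<alpha>, 1 - l2, -\<alpha> - l6)\<close>,
    \<open>(-\<alpha> - l4, \<alpha>\<^sup>2 - l5, -\<alpha> - l6, \<alpha>\<^sup>2 - l3)\<close>,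
  minus \<open>l1\<close> times \<open>Y_matrix m L\<close> padded with zero blocks.\<close>
definition lmi_matrix ::
  "real \<Rightarrow> real \<Rightarrow> real \<Rightarrow> real \<Rightarrow> real \<Rightarrow> real \<Rightarrow> real \<Rightarrow> real \<Rightarrow> real \<Rightarrow> real \<Rightarrow> real^(2 + 2)^(2 + 2)" where
  "lmi_matrix m L \<alpha> \<rho> l1 l2 l3 l4 l5 l6 =
     block_matrix
       (matrix2 (1 - \<rho>\<^sup>2) (- \<alpha>)
                (- \<alpha>)     (\<alpha>\<^sup>2))
       (matrix2 1         (- \<alpha> - l4)
                (- \<alpha>)     (\<alpha>\<^sup>2 - l5))
       (matrix2 1         (- \<alpha>)
                (- \<alpha> - l4) (\<alpha>\<^sup>2 - l5))
       (matrix2 (1 - l2)  (- \<alpha> - l6)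
                (- \<alpha> - l6) (\<alpha>\<^sup>2 - l3))
     - l1 *\<^sub>R block_matrix (Y_matrix m L) 0 0 0"

definition iid_process :: "'a measure \<Rightarrow> (nat \<Rightarrow> 'a \<Rightarrow> 'b::euclidean_space) \<Rightarrow> bool" where
  "iid_process M v \<longleftrightarrow>
     prob_space.indep_vars M (\<lambda>_. borel) v UNIV \<and>
     (\<forall>s t. distr M borel (v s) = distr M borel (v t))"

end

theory Submission
  imports Defs
begin

text \<open>Write \<open>e = x\<^sub>t - x\<^sub>t\<^sup>*\<close>, \<open>g = \<nabla>f\<^sub>t(x\<^sub>t)\<close>, \<open>d = x\<^sub>t\<^sup>* - x\<^sub>t\<^sub>+\<^sub>1\<^sup>*\<close>, \<open>w = v\<^sub>t\<close>, so that the next error is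
  \<open>e - \<alpha>g + d - \<alpha>w\<close>. Evaluating the linear matrix inequality at the coordinates of \<open>(e, g, d, w)\<close> and
  summing bounds the squared norm of the next error by \<open>\<rho>\<^sup>2|e|\<^sup>2 + l\<^sub>2|d|\<^sup>2 + l\<^sub>3|w|\<^sup>2\<close>, up to the
  sector term, which has the right sign, and the cross terms \<open>e \<bullet> w\<close>, \<open>g \<bullet> w\<close>, \<open>d \<bullet> w\<close>. The latter
  vanish in expectation, since \<open>e\<close> and \<open>g\<close> are measurable functions of \<open>v\<^sub>0, \<dots>, v\<^sub>t\<^sub>-\<^sub>1\<close> and are
  therefore independent of the centred noise \<open>w\<close>.\<close>

section \<open>Block matrices and the quadratic form of the matrix inequality\<close>

lemma inner_stack: "stack a b \<bullet> stack c d = a \<bullet> c + b \<bullet> d"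
  by (simp add: inner_vec_def stack_def UNIV_Plus_UNIV[symmetric] sum.Plus del: UNIV_Plus_UNIV)

lemma block_matrix_mult_stack:
  "block_matrix A B C D *v stack a b = stack (A *v a + B *v b) (C *v a + D *v b)"
proof (rule vec_eq_iff[THEN iffD2], rule allI)
  fix i
  show "(block_matrix A B C D *v stack a b) $ i = stack (A *v a + B *v b) (C *v a + D *v b) $ i"
    by (cases i) (simp_all add: block_matrix_def stack_def matrix_vector_mult_def
        UNIV_Plus_UNIV[symmetric] sum.Plus del: UNIV_Plus_UNIV)
qed

lemma inner_matrix2:
  "(vector [a, b] :: real^2) \<bullet> (matrix2 p q r s *v vector [c, d])
     = a * (p * c + q * d) + b * (r * c + s * d)"
  by (simp add: matrix2_def inner_vec_def matrix_vector_mult_def sum_2)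

lemma mat_mult_vec: "(mat k :: real^'n^'n) *v x = k *\<^sub>R x"
proof -
  have "(mat k :: real^'n^'n) = k *\<^sub>R mat 1"
    by (simp add: vec_eq_iff mat_def)
  then show ?thesis
    by (simp add: scaleR_matrix_vector_assoc[symmetric])
qed

text \<open>With all multipliers and \<open>\<rho>\<close> set to zero, the matrix is the outer
  product of \<open>(1, -\<alpha>, 1, -\<alpha>)\<close> with itself, whose quadratic form is the
  square on the left. The remaining entries, with their signs, make up the right-hand side.\<close>

lemma lmi_scalar:
  assumes "negative_semidefinite (lmi_matrix m L \<alpha> \<rho> l1 l2 l3 l4 l5 l6)"
  shows "(e - \<alpha> * g + d - \<alpha> * w)\<^sup>2
    \<le> \<rho>\<^sup>2 * (e * e) + l2 * (d * d) + l3 * (w * w)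
      + 2 * l4 * (e * w) + 2 * l5 * (g * w) + 2 * l6 * (d * w)
      - l1 * (- 2 * m * L * (e * e) + 2 * (L + m) * (e * g) - 2 * (g * g))"
proof -
  let ?z = "stack (vector [e, g] :: real^2) (vector [d, w] :: real^2)"
  have "?z \<bullet> (lmi_matrix m L \<alpha> \<rho> l1 l2 l3 l4 l5 l6 *v ?z) \<le> 0"
    using assms by (simp add: negative_semidefinite_def)
  then show ?thesis
    unfolding lmi_matrix_def Y_matrix_def
    by (simp add: matrix_vector_mult_diff_rdistrib scaleR_matrix_vector_assoc[symmetric]
        block_matrix_mult_stack inner_stack inner_diff_right inner_add_right inner_matrix2)
      (simp add: algebra_simps power2_eq_square)
qed

text \<open>Summing the scalar inequality over coordinates turns products into inner products. This
  replaces a Kronecker product of the matrix with the identity.\<close>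

lemma lmi_vector:
  fixes e g d w :: "real^'p"
  assumes "negative_semidefinite (lmi_matrix m L \<alpha> \<rho> l1 l2 l3 l4 l5 l6)"
  shows "(norm (e - \<alpha> *\<^sub>R g + d - \<alpha> *\<^sub>R w))\<^sup>2
    \<le> \<rho>\<^sup>2 * (norm e)\<^sup>2 + l2 * (norm d)\<^sup>2 + l3 * (norm w)\<^sup>2
      + 2 * l4 * (e \<bullet> w) + 2 * l5 * (g \<bullet> w) + 2 * l6 * (d \<bullet> w)
      - l1 * (- 2 * m * L * (e \<bullet> e) + 2 * (L + m) * (e \<bullet> g) - 2 * (g \<bullet> g))"
proof -
  have "(norm (e - \<alpha> *\<^sub>R g + d - \<alpha> *\<^sub>R w))\<^sup>2
      = (\<Sum>i\<in>UNIV. (e $ i - \<alpha> * g $ i + d $ i - \<alpha> * w $ i)\<^sup>2)"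
    unfolding power2_norm_eq_inner inner_vec_def by (simp add: power2_eq_square)
  also have "\<dots> \<le> (\<Sum>i\<in>UNIV. \<rho>\<^sup>2 * (e $ i * e $ i) + l2 * (d $ i * d $ i) + l3 * (w $ i * w $ i)
      + 2 * l4 * (e $ i * w $ i) + 2 * l5 * (g $ i * w $ i) + 2 * l6 * (d $ i * w $ i)
      - l1 * (- 2 * m * L * (e $ i * e $ i) + 2 * (L + m) * (e $ i * g $ i) - 2 * (g $ i * g $ i)))"
    by (rule sum_mono) (rule lmi_scalar[OF assms])
  also have "\<dots> = \<rho>\<^sup>2 * (norm e)\<^sup>2 + l2 * (norm d)\<^sup>2 + l3 * (norm w)\<^sup>2
      + 2 * l4 * (e \<bullet> w) + 2 * l5 * (g \<bullet> w) + 2 * l6 * (d \<bullet> w)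
      - l1 * (- 2 * m * L * (e \<bullet> e) + 2 * (L + m) * (e \<bullet> g) - 2 * (g \<bullet> g))"
    by (simp only: power2_norm_eq_inner inner_vec_def inner_real_def sum.distrib sum_subtractf
        sum_distrib_left[symmetric])
  finally show ?thesis .
qed

section \<open>Consequences of the sector condition\<close>

text \<open>The minimizer bound inside \<open>sector_class\<close> must be \<open>xs\<close> by its
  uniqueness clause; expanding the blocks then gives the multiplier of \<open>l1\<close> in
  \<open>lmi_vector\<close>.\<close>

lemma sector_class_inequality:
  assumes "f \<in> sector_class m L" and "is_arg_min f (\<lambda>_. True) xs"
  shows "0 \<le> - 2 * m * L * ((x - xs) \<bullet> (x - xs)) + 2 * (L + m) * ((x - xs) \<bullet> gradient f x)
             - 2 * (gradient f x \<bullet> gradient f x)"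
proof -
  obtain z where z: "\<And>y. is_arg_min f (\<lambda>_. True) y \<longleftrightarrow> y = z"
    and ineq: "\<And>x. stack (x - z) (gradient f x) \<bullet>
      (block_matrix (mat (- 2 * m * L)) (mat (L + m)) (mat (L + m)) (mat (- 2))
        *v stack (x - z) (gradient f x)) \<ge> 0"
    using assms(1) unfolding sector_class_def by auto
  have "stack (x - xs) (gradient f x) \<bullet>
      (block_matrix (mat (- 2 * m * L)) (mat (L + m)) (mat (L + m)) (mat (- 2))
        *v stack (x - xs) (gradient f x)) \<ge> 0"
    using ineq z assms(2) by simp
  then show ?thesis
    by (simp add: block_matrix_mult_stack inner_stack mat_mult_vec inner_add_right inner_commute
        algebra_simps)
qed

text \<open>Discarding the term in \<open>m * L\<close> leaves a bound on the squared gradient by an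
  inner product; Cauchy-Schwarz and cancellation finish. The constant is not sharp: the bound only
  serves to make the gradient square integrable.\<close>

lemma sector_class_gradient_bound:
  assumes "f \<in> sector_class m L" and "is_arg_min f (\<lambda>_. True) xs" and "0 < m" and "m \<le> L"
  shows "norm (gradient f x) \<le> (L + m) * norm (x - xs)"
proof (cases "gradient f x = 0")
  case True
  then show ?thesis using assms by simp
next
  case False
  let ?e = "x - xs" and ?g = "gradient f x"
  have "0 \<le> m * L * (?e \<bullet> ?e)"
    using assms by simp
  then have "?g \<bullet> ?g \<le> (L + m) * (?e \<bullet> ?g)"
    using sector_class_inequality[OF assms(1,2), of x] by (simp add: algebra_simps)
  also have "\<dots> \<le> (L + m) * (norm ?e * norm ?g)"
    using assms by (intro mult_left_mono norm_cauchy_schwarz) auto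
  finally have "norm ?g * norm ?g \<le> ((L + m) * norm ?e) * norm ?g"
    by (simp add: norm_eq_sqrt_inner mult.assoc)
  then show ?thesis
    using False by simp
qed

section \<open>Existence and measurability of gradients\<close>

text \<open>The adjoint of the derivative, applied to 1, is its Riesz representative; uniqueness of
  derivatives then makes the definite description well defined.\<close>

lemma GDERIV_gradient:
  fixes f :: "'b::euclidean_space \<Rightarrow> real"
  assumes "f differentiable (at x)"
  shows "GDERIV f x :> gradient f x"
proof -
  obtain f' where f': "(f has_derivative f') (at x)"
    using assms by (auto simp: differentiable_def)
  then have "linear f'"
    by (rule has_derivative_linear)
  have "f' = (\<lambda>h. h \<bullet> adjoint f' 1)"
    using adjoint_works[OF \<open>linear f'\<close>, of _ "1::real"] by auto
  with f' have D: "GDERIV f x :> adjoint f' 1"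
    by (simp add: gderiv_def)
  show ?thesis
    unfolding gradient_def
  proof (rule theI[where P = "\<lambda>D. GDERIV f x :> D", OF D])
    fix D' assume "GDERIV f x :> D'"
    with D have "(\<lambda>h. h \<bullet> D') = (\<lambda>h. h \<bullet> adjoint f' 1)"
      unfolding gderiv_def by (rule has_derivative_unique[rotated])
    then have "\<And>h. h \<bullet> D' = h \<bullet> adjoint f' 1"
      by meson
    then show "D' = adjoint f' 1"
      using vector_eq_ldot[of D' "adjoint f' 1"] by blast
  qed
qed

text \<open>The gradient of a differentiable function need not be continuous, but its coordinates are
  pointwise limits of difference quotients.\<close>

lemma borel_measurable_gradient:
  fixes f :: "'b::euclidean_space \<Rightarrow> real"
  assumes "\<And>x. f differentiable (at x)"
  shows "gradient f \<in> borel_measurable borel"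
proof (rule borel_measurable_euclidean_space[THEN iffD2], rule ballI)
  fix b :: 'b assume "b \<in> Basis"
  have "continuous_on UNIV f"
    using assms differentiable_imp_continuous_on differentiable_on_def by blast
  then have f[measurable]: "f \<in> borel_measurable borel"
    by (rule borel_measurable_continuous_onI)
  show "(\<lambda>x. gradient f x \<bullet> b) \<in> borel_measurable borel"
  proof (rule borel_measurable_LIMSEQ_real)
    fix x
    have "((\<lambda>s. x + s *\<^sub>R b) has_derivative (\<lambda>s. s *\<^sub>R b)) (at 0)"
      by (auto intro!: derivative_eq_intros)
    moreover have "(f has_derivative (\<lambda>h. h \<bullet> gradient f x)) (at (x + 0 *\<^sub>R b))"
      using GDERIV_gradient[OF assms, of x] by (simp add: gderiv_def)
    ultimately have "((\<lambda>s. f (x + s *\<^sub>R b)) has_derivative (\<lambda>s. (s *\<^sub>R b) \<bullet> gradient f x)) (at 0)"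
      by (rule has_derivative_compose)
    then have "((\<lambda>s. f (x + s *\<^sub>R b)) has_real_derivative (gradient f x \<bullet> b)) (at 0)"
      by (simp add: has_field_derivative_def inner_commute mult.commute[of "gradient f x \<bullet> b"] mult_commute_abs)
    then have lim: "(\<lambda>s. (f (x + s *\<^sub>R b) - f x) / s) \<midarrow>0\<rightarrow> gradient f x \<bullet> b"
      by (simp add: DERIV_def)
    \<comment> \<open>The step sizes \<open>1 / (n + 1)\<close> avoid 0, so the limit over the
      punctured neighbourhood becomes a limit along a sequence.\<close>
    have "filterlim (\<lambda>n. inverse (real (Suc n))) (at 0) sequentially"
      using LIMSEQ_inverse_real_of_nat by (simp add: filterlim_at)
    from filterlim_compose[OF lim this]
    show "(\<lambda>n. (f (x + inverse (real (Suc n)) *\<^sub>R b) - f x) / inverse (real (Suc n)))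
        \<longlonglongrightarrow> gradient f x \<bullet> b" .
  qed measurable
qed

section \<open>Integrability of squared norms\<close>

lemma integrable_power2_norm_add:
  fixes X Y :: "'a \<Rightarrow> 'b::euclidean_space"
  assumes [measurable]: "X \<in> borel_measurable M" "Y \<in> borel_measurable M"
    and X: "integrable M (\<lambda>\<omega>. (norm (X \<omega>))\<^sup>2)" and Y: "integrable M (\<lambda>\<omega>. (norm (Y \<omega>))\<^sup>2)"
  shows "integrable M (\<lambda>\<omega>. (norm (X \<omega> + Y \<omega>))\<^sup>2)"
proof (rule Bochner_Integration.integrable_bound)
  show "integrable M (\<lambda>\<omega>. 2 * (norm (X \<omega>))\<^sup>2 + 2 * (norm (Y \<omega>))\<^sup>2)"
    using X Y by simp
  show "AE \<omega> in M. norm ((norm (X \<omega> + Y \<omega>))\<^sup>2) \<le> norm (2 * (norm (X \<omega>))\<^sup>2 + 2 * (norm (Y \<omega>))\<^sup>2)"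
  proof (rule AE_I2)
    fix \<omega>
    have "(norm (X \<omega> + Y \<omega>))\<^sup>2 \<le> (norm (X \<omega>) + norm (Y \<omega>))\<^sup>2"
      by (intro power_mono norm_triangle_ineq) simp
    also have "\<dots> \<le> 2 * (norm (X \<omega>))\<^sup>2 + 2 * (norm (Y \<omega>))\<^sup>2"
      using sum_squares_bound[of "norm (X \<omega>)" "norm (Y \<omega>)"] by (simp add: power2_sum)
    finally show "norm ((norm (X \<omega> + Y \<omega>))\<^sup>2) \<le> norm (2 * (norm (X \<omega>))\<^sup>2 + 2 * (norm (Y \<omega>))\<^sup>2)"
      by simp
  qed
qed measurable

context prob_space
begin

text \<open>Constants are integrable on a probability space, so \<open>1 + (norm X)^2\<close> is an
  integrable majorant.\<close>

lemma integrable_of_power2_norm: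
  fixes X :: "'a \<Rightarrow> 'b::euclidean_space"
  assumes [measurable]: "X \<in> borel_measurable M" and "integrable M (\<lambda>\<omega>. (norm (X \<omega>))\<^sup>2)"
  shows "integrable M X"
proof (rule Bochner_Integration.integrable_bound)
  show "integrable M (\<lambda>\<omega>. 1 + (norm (X \<omega>))\<^sup>2)"
    using assms by simp
  show "AE \<omega> in M. norm (X \<omega>) \<le> norm (1 + (norm (X \<omega>))\<^sup>2)"
  proof (rule AE_I2)
    fix \<omega>
    show "norm (X \<omega>) \<le> norm (1 + (norm (X \<omega>))\<^sup>2)"
      using sum_squares_bound[of "norm (X \<omega>)" 1] norm_ge_zero[of "X \<omega>"]
        unfolding power2_eq_square real_norm_def by linarith
  qed
qed measurable

section \<open>Independence of the noise from the past\<close>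

text \<open>In each coordinate the expectation of the product factors, and the factor from
  \<open>V\<close> is 0.\<close>

lemma indep_var_inner_centred:
  fixes X V :: "'a \<Rightarrow> 'b::euclidean_space"
  assumes indep: "indep_var borel X borel V"
    and X: "integrable M X" and V: "integrable M V" "expectation V = 0"
  shows "integrable M (\<lambda>\<omega>. X \<omega> \<bullet> V \<omega>)" and "expectation (\<lambda>\<omega>. X \<omega> \<bullet> V \<omega>) = 0"
proof -
  have coord: "integrable M (\<lambda>\<omega>. (X \<omega> \<bullet> b) * (V \<omega> \<bullet> b)) \<and> expectation (\<lambda>\<omega>. (X \<omega> \<bullet> b) * (V \<omega> \<bullet> b)) = 0"
    for b :: 'b
  proof -
    have "indep_var borel ((\<lambda>y. y \<bullet> b) \<circ> X) borel ((\<lambda>y. y \<bullet> b) \<circ> V)"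
      by (rule indep_var_compose[OF indep]) measurable
    then have ind: "indep_var borel (\<lambda>\<omega>. X \<omega> \<bullet> b) borel (\<lambda>\<omega>. V \<omega> \<bullet> b)"
      by (simp add: comp_def)
    have int: "integrable M (\<lambda>\<omega>. X \<omega> \<bullet> b)" "integrable M (\<lambda>\<omega>. V \<omega> \<bullet> b)"
      using X V by simp_all
    have "expectation (\<lambda>\<omega>. V \<omega> \<bullet> b) = 0"
      using V by simp
    then show ?thesis
      using indep_var_integrable[OF ind int] indep_var_lebesgue_integral[OF ind int] by simp
  qed
  show "integrable M (\<lambda>\<omega>. X \<omega> \<bullet> V \<omega>)" and "expectation (\<lambda>\<omega>. X \<omega> \<bullet> V \<omega>) = 0"
    using coord by (simp_all add: euclidean_inner[of "X _" "V _"])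
qed

text \<open>Unrolling the recursion shows that \<open>x t\<close> uses only the noises with index
  strictly below \<open>t\<close>. The factorization is through restricted families so that
  independence of disjoint index blocks applies.\<close>

lemma recursion_factors_through_past:
  fixes x v :: "nat \<Rightarrow> 'a \<Rightarrow> 'b::euclidean_space"
  assumes x0: "\<And>\<omega>. \<omega> \<in> space M \<Longrightarrow> x 0 \<omega> = x0"
    and step: "\<And>n \<omega>. \<omega> \<in> space M \<Longrightarrow> x (Suc n) \<omega> = G n (x n \<omega>) (v n \<omega>)"
    and G: "\<And>n. case_prod (G n) \<in> borel_measurable (borel \<Otimes>\<^sub>M borel)"
  shows "\<exists>F\<in>borel_measurable (Pi\<^sub>M {..<t} (\<lambda>_. borel)).
    \<forall>\<omega>\<in>space M. x t \<omega> = F (restrict (\<lambda>i. v i \<omega>) {..<t})"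
proof (induction t)
  case 0
  show ?case
    by (rule bexI[of _ "\<lambda>_. x0"]) (simp_all add: x0)
next
  case (Suc t)
  then obtain F where F: "F \<in> borel_measurable (Pi\<^sub>M {..<t} (\<lambda>_. borel))"
    and eq: "\<And>\<omega>. \<omega> \<in> space M \<Longrightarrow> x t \<omega> = F (restrict (\<lambda>i. v i \<omega>) {..<t})"
    by blast
  \<comment> \<open>One more step of the recursion: the first \<open>t\<close> coordinates give the
    old state, coordinate \<open>t\<close> the new noise.\<close>
  let ?F = "\<lambda>y. G t (F (restrict y {..<t})) (y t)"
  have "(\<lambda>y. (F (restrict y {..<t}), y t))
      \<in> Pi\<^sub>M {..<Suc t} (\<lambda>_. borel) \<rightarrow>\<^sub>M (borel \<Otimes>\<^sub>M borel :: ('b \<times> 'b) measure)"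
    by (intro measurable_Pair measurable_compose[OF measurable_restrict_subset F]
        measurable_component_singleton) auto
  from measurable_compose[OF this G[of t]]
  have "?F \<in> borel_measurable (Pi\<^sub>M {..<Suc t} (\<lambda>_. borel))"
    by simp
  moreover have "x (Suc t) \<omega> = ?F (restrict (\<lambda>i. v i \<omega>) {..<Suc t})" if "\<omega> \<in> space M" for \<omega>
  proof -
    have "{..<Suc t} \<inter> {..<t} = {..<t}" by auto
    then show ?thesis
      using that by (simp add: step eq)
  qed
  ultimately show ?case
    by (intro bexI[of _ ?F] ballI)
qed

text \<open>The index blocks \<open>{..<t}\<close> and \<open>{t}\<close> are disjoint, so functions
  of the two noise families are independent.\<close>

lemma indep_var_past_present:
  fixes x v :: "nat \<Rightarrow> 'a \<Rightarrow> 'b::euclidean_space"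
  assumes indep: "indep_vars (\<lambda>_. borel) v UNIV"
    and x0: "\<And>\<omega>. \<omega> \<in> space M \<Longrightarrow> x 0 \<omega> = x0"
    and step: "\<And>n \<omega>. \<omega> \<in> space M \<Longrightarrow> x (Suc n) \<omega> = G n (x n \<omega>) (v n \<omega>)"
    and G: "\<And>n. case_prod (G n) \<in> borel_measurable (borel \<Otimes>\<^sub>M borel)"
  shows "indep_var borel (x t) borel (v t)"
proof -
  obtain F where F: "F \<in> borel_measurable (Pi\<^sub>M {..<t} (\<lambda>_. borel))"
    and eq: "\<And>\<omega>. \<omega> \<in> space M \<Longrightarrow> x t \<omega> = F (restrict (\<lambda>i. v i \<omega>) {..<t})"
    using recursion_factors_through_past[of x x0 G v, OF x0 step G] by blast
  have "indep_var (Pi\<^sub>M {..<t} (\<lambda>_. borel)) (\<lambda>\<omega>. restrict (\<lambda>i. v i \<omega>) {..<t})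
      (Pi\<^sub>M {t} (\<lambda>_. borel)) (\<lambda>\<omega>. restrict (\<lambda>i. v i \<omega>) {t})"
    by (rule indep_var_restrict[OF indep]) auto
  then have "indep_var borel (F \<circ> (\<lambda>\<omega>. restrict (\<lambda>i. v i \<omega>) {..<t}))
      borel ((\<lambda>y. y t) \<circ> (\<lambda>\<omega>. restrict (\<lambda>i. v i \<omega>) {t}))"
    by (rule indep_var_compose) (use F in \<open>auto intro: measurable_component_singleton\<close>)
  then have ind: "indep_var borel (\<lambda>\<omega>. F (restrict (\<lambda>i. v i \<omega>) {..<t})) borel (v t)"
    by (simp add: comp_def)
  \<comment> \<open>\<open>x t\<close> equals its factorized form only on \<open>space M\<close>;
    phrasing independence through distributions makes this enough.\<close>
  show ?thesis
    by (rule indep_var_distribution_eq[THEN iffD2])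
      (use ind eq in \<open>simp add: indep_var_distribution_eq cong: measurable_cong distr_cong\<close>)
qed

end

section \<open>The one-step bound on the mean square error\<close>

theorem lemma4p1:
  fixes M :: "'a measure"
    and f :: "nat \<Rightarrow> real^'p \<Rightarrow> real"
    and v x :: "nat \<Rightarrow> 'a \<Rightarrow> real^'p"
    and xstar :: "nat \<Rightarrow> real^'p"
    and x0 :: "real^'p"
    and m L \<sigma> c \<alpha> :: "nat \<Rightarrow> real"
    and t :: nat
    and \<rho> l1 l2 l3 l4 l5 l6 :: real
  assumes "prob_space M"
    and "\<And>t. 0 < m t" and "\<And>t. m t \<le> L t"
    and "\<And>t. 0 \<le> \<sigma> t" and "\<And>t. 0 \<le> c t" and "\<And>t. 0 \<le> \<alpha> t"
    and "\<And>\<omega>. \<omega> \<in> space M \<Longrightarrow> x 0 \<omega> = x0"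
    and "\<And>t \<omega>. \<omega> \<in> space M \<Longrightarrow>
           x (Suc t) \<omega> = x t \<omega> - \<alpha> t *\<^sub>R (gradient (f t) (x t \<omega>) + v t \<omega>)"
    and "\<And>t. f t \<in> sector_class (m t) (L t)"
    and "\<And>t. is_arg_min (f t) (\<lambda>_. True) (xstar t)"
    and "\<And>t. norm (xstar (Suc t) - xstar t) \<le> \<sigma> t"
    and "iid_process M v"
    and "\<And>t. integrable M (v t)" and "\<And>t. (\<integral>\<omega>. v t \<omega> \<partial>M) = 0"
    and "\<And>t. integrable M (\<lambda>\<omega>. (norm (v t \<omega>))\<^sup>2)"
    and "\<And>t. (\<integral>\<omega>. (norm (v t \<omega>))\<^sup>2 \<partial>M) \<le> (c t)\<^sup>2"
    and "0 \<le> \<rho>" and "0 \<le> l1" and "0 \<le> l2" and "0 \<le> l3"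
    and "negative_semidefinite (lmi_matrix (m t) (L t) (\<alpha> t) \<rho> l1 l2 l3 l4 l5 l6)"
  shows "integrable M (\<lambda>\<omega>. (norm (x t \<omega> - xstar t))\<^sup>2) \<and>
         integrable M (\<lambda>\<omega>. (norm (x (Suc t) \<omega> - xstar (Suc t)))\<^sup>2) \<and>
         (\<integral>\<omega>. (norm (x (Suc t) \<omega> - xstar (Suc t)))\<^sup>2 \<partial>M)
           \<le> \<rho>\<^sup>2 * (\<integral>\<omega>. (norm (x t \<omega> - xstar t))\<^sup>2 \<partial>M) + l2 * (\<sigma> t)\<^sup>2 + l3 * (c t)\<^sup>2"
proof -
  interpret prob_space M by fact
  note arg_min = assms(10) and sector = assms(9)
  have grad[measurable]: "gradient (f n) \<in> borel_measurable borel" for n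
    using sector[of n] by (intro borel_measurable_gradient) (auto simp: sector_class_def)
  have v[measurable]: "v n \<in> borel_measurable M" for n
    using assms(13) by (rule borel_measurable_integrable)
  define G where "G n y w = y - \<alpha> n *\<^sub>R (gradient (f n) y + w)" for n y w
  have G: "case_prod (G n) \<in> borel_measurable (borel \<Otimes>\<^sub>M borel)" for n
    unfolding G_def by measurable
  have step: "x (Suc n) \<omega> = G n (x n \<omega>) (v n \<omega>)" if "\<omega> \<in> space M" for n \<omega>
    using assms(8)[OF that] by (simp add: G_def)
  have indep: "indep_var borel (x n) borel (v n)" for n
    by (rule indep_var_past_present[of v x x0 G, OF _ assms(7) step G])
      (use assms(12) in \<open>auto simp: iid_process_def\<close>)
  have x[measurable]: "x n \<in> borel_measurable M" for n
    using indep_var_rv1[OF indep] .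
  \<comment> \<open>Conditional on the error at the same time, so that it can be used inside the
    induction for \<open>x_int\<close>.\<close>
  have grad_int: "integrable M (\<lambda>\<omega>. (norm (gradient (f n) (x n \<omega>)))\<^sup>2)"
    if "integrable M (\<lambda>\<omega>. (norm (x n \<omega> - xstar n))\<^sup>2)" for n
  proof (rule Bochner_Integration.integrable_bound)
    show "integrable M (\<lambda>\<omega>. (L n + m n)\<^sup>2 * (norm (x n \<omega> - xstar n))\<^sup>2)"
      using that by simp
    show "AE \<omega> in M. norm ((norm (gradient (f n) (x n \<omega>)))\<^sup>2)
        \<le> norm ((L n + m n)\<^sup>2 * (norm (x n \<omega> - xstar n))\<^sup>2)"
    proof (rule AE_I2)
      fix \<omega>
      have "(norm (gradient (f n) (x n \<omega>)))\<^sup>2 \<le> ((L n + m n) * norm (x n \<omega> - xstar n))\<^sup>2"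
        using sector_class_gradient_bound[OF sector arg_min assms(2,3)] by (intro power_mono) auto
      then show "norm ((norm (gradient (f n) (x n \<omega>)))\<^sup>2)
          \<le> norm ((L n + m n)\<^sup>2 * (norm (x n \<omega> - xstar n))\<^sup>2)"
        by (simp add: power_mult_distrib)
    qed
  qed measurable
  \<comment> \<open>Integrability must precede any comparison of expectations, since the integral of
    a non-integrable function is 0 by default.\<close>
  have x_int: "integrable M (\<lambda>\<omega>. (norm (x n \<omega> - xstar n))\<^sup>2)" for n
  proof (induction n)
    case 0
    have "integrable M (\<lambda>\<omega>. (norm (x0 - xstar 0))\<^sup>2)"
      by simp
    then show ?case
      by (subst Bochner_Integration.integrable_cong[OF refl]) (auto simp: assms(7))
  next
    case (Suc n)
    have scaled: "integrable M (\<lambda>\<omega>. (norm (- \<alpha> n *\<^sub>R Y \<omega>))\<^sup>2)"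
      if "integrable M (\<lambda>\<omega>. (norm (Y \<omega>))\<^sup>2)" for Y :: "'a \<Rightarrow> real^'p"
      using that by (simp add: power_mult_distrib)
    \<comment> \<open>The next error as a sum of four square-integrable terms, with the minus signs
      absorbed into the scalars so that the lemma on sums applies.\<close>
    have "integrable M (\<lambda>\<omega>. (norm (((x n \<omega> - xstar n) + - \<alpha> n *\<^sub>R gradient (f n) (x n \<omega>)
        + - \<alpha> n *\<^sub>R v n \<omega>) + (xstar n - xstar (Suc n))))\<^sup>2)"
      by (intro integrable_power2_norm_add scaled grad_int Suc.IH assms(15)) simp_all
    then show ?case
      by (rule Bochner_Integration.integrable_cong[OF refl, THEN iffD1, rotated])
        (simp add: assms(8) algebra_simps)
  qed
  define e where "e \<omega> = x t \<omega> - xstar t" for \<omega>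
  define g where "g \<omega> = gradient (f t) (x t \<omega>)" for \<omega>
  \<comment> \<open>This sign lets the drift enter the next error with coefficient 1, as in the
    third row of the matrix.\<close>
  define d where "d = xstar t - xstar (Suc t)"
  have [measurable]: "e \<in> borel_measurable M" "g \<in> borel_measurable M"
    unfolding e_def g_def by measurable
  have e_sq: "integrable M (\<lambda>\<omega>. (norm (e \<omega>))\<^sup>2)"
    using x_int by (simp add: e_def)
  have g_sq: "integrable M (\<lambda>\<omega>. (norm (g \<omega>))\<^sup>2)"
    using grad_int[OF x_int] by (simp add: g_def)
  \<comment> \<open>Taking \<open>h\<close> to be a translation, the gradient or a constant covers
    \<open>e\<close>, \<open>g\<close> and \<open>d\<close> at once.\<close>
  have past: "indep_var borel (\<lambda>\<omega>. h (x t \<omega>)) borel (v t)"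
    if "h \<in> borel_measurable borel" for h :: "real^'p \<Rightarrow> real^'p"
    using indep_var_compose[OF indep that, of id] by (simp add: comp_def id_def)
  have "indep_var borel e borel (v t)" "indep_var borel g borel (v t)"
    "indep_var borel (\<lambda>_. d) borel (v t)"
    unfolding e_def g_def by (intro past; measurable)+
  then have ev: "integrable M (\<lambda>\<omega>. e \<omega> \<bullet> v t \<omega>)" "expectation (\<lambda>\<omega>. e \<omega> \<bullet> v t \<omega>) = 0"
    and gv: "integrable M (\<lambda>\<omega>. g \<omega> \<bullet> v t \<omega>)" "expectation (\<lambda>\<omega>. g \<omega> \<bullet> v t \<omega>) = 0"
    and dv: "integrable M (\<lambda>\<omega>. d \<bullet> v t \<omega>)" "expectation (\<lambda>\<omega>. d \<bullet> v t \<omega>) = 0"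
    by (simp_all add: indep_var_inner_centred assms(13,14) integrable_of_power2_norm e_sq g_sq)
  have pointwise: "(norm (x (Suc t) \<omega> - xstar (Suc t)))\<^sup>2
    \<le> \<rho>\<^sup>2 * (norm (e \<omega>))\<^sup>2 + l2 * (norm d)\<^sup>2 + l3 * (norm (v t \<omega>))\<^sup>2
      + 2 * l4 * (e \<omega> \<bullet> v t \<omega>) + 2 * l5 * (g \<omega> \<bullet> v t \<omega>) + 2 * l6 * (d \<bullet> v t \<omega>)"
    if "\<omega> \<in> space M" for \<omega>
  proof -
    have eq: "x (Suc t) \<omega> - xstar (Suc t) = e \<omega> - \<alpha> t *\<^sub>R g \<omega> + d - \<alpha> t *\<^sub>R v t \<omega>"
      using assms(8)[OF that, of t] by (simp add: e_def g_def d_def algebra_simps)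
    have "0 \<le> l1 * (- 2 * m t * L t * (e \<omega> \<bullet> e \<omega>) + 2 * (L t + m t) * (e \<omega> \<bullet> g \<omega>)
        - 2 * (g \<omega> \<bullet> g \<omega>))"
      using sector_class_inequality[OF sector arg_min, of t "x t \<omega>"] assms(18)
      unfolding e_def g_def by (rule mult_nonneg_nonneg[rotated])
    then show ?thesis
      unfolding eq using lmi_vector[OF assms(21), of "e \<omega>" "g \<omega>" d "v t \<omega>"] by linarith
  qed
  have "expectation (\<lambda>\<omega>. (norm (x (Suc t) \<omega> - xstar (Suc t)))\<^sup>2)
    \<le> expectation (\<lambda>\<omega>. \<rho>\<^sup>2 * (norm (e \<omega>))\<^sup>2 + l2 * (norm d)\<^sup>2 + l3 * (norm (v t \<omega>))\<^sup>2
      + 2 * l4 * (e \<omega> \<bullet> v t \<omega>) + 2 * l5 * (g \<omega> \<bullet> v t \<omega>) + 2 * l6 * (d \<bullet> v t \<omega>))"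
    using x_int e_sq assms(15) ev gv dv by (intro integral_mono pointwise) simp_all
  \<comment> \<open>The three cross terms integrate to 0, whatever the signs of \<open>l4\<close>,
    \<open>l5\<close> and \<open>l6\<close>; the constant drift term integrates to itself because
    \<open>M\<close> has mass 1.\<close>
  also have "\<dots> = \<rho>\<^sup>2 * expectation (\<lambda>\<omega>. (norm (e \<omega>))\<^sup>2) + l2 * (norm d)\<^sup>2
      + l3 * expectation (\<lambda>\<omega>. (norm (v t \<omega>))\<^sup>2)"
    using e_sq assms(15) ev gv dv by (simp add: prob_space)
  also have "\<dots> \<le> \<rho>\<^sup>2 * expectation (\<lambda>\<omega>. (norm (e \<omega>))\<^sup>2) + l2 * (\<sigma> t)\<^sup>2 + l3 * (c t)\<^sup>2"
    using assms(11)[of t] assms(16,19,20)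
    by (intro add_mono mult_left_mono power_mono order_refl) (simp_all add: d_def norm_minus_commute)
  finally show ?thesis
    using x_int by (simp add: e_def)
qed

end
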